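(* Let $G$ be a three-dimensional Lie group with a bi-invariant metric $\langle\,,\rangle$ and Lie algebra $\mathfrak{g}$. Let $\alpha:I\subset\mathbb{R}\to G$ be an arc-length parametrized slant helix, and let $\gamma$ be the normal indicatrix of $\alpha$, a curve on the unit sphere $S^2\subset\mathfrak{g}$. Then $\gamma$ is a plane curve on $S^2$.
   Context: $\mathfrak{g}$ is the Lie algebra of left-invariant vector fields of $G$ and $D$ is the Levi-Civita connection, so $D_XY=\frac12[X,Y]$ for $X,Y\in\mathfrak{g}$. Let $\{X_1,X_2,X_3\}$ be an orthonormal basis of $\mathfrak{g}$. Vector fields along $\alpha$ are written $W=\sum_i w_iX_i$ with smooth $w_i:I\to\mathbb{R}$; one sets $\dot W=\sum_i w_i'X_i$, brackets are extended bilinearly over functions, and $D_{\alpha'}W=\dot W+\frac12[T,W]$ with $T=\alpha'$. The Frenet apparatus of a unit speed curve consists of the positively oriented orthonormal frame $T=\alpha',N,B=T\times N$, the curvature $\varkappa=\|\dot T\|>0$ and the torsion $\tau$, with $D_TT=\varkappa N$, $D_TN=-\varkappa T+\tau B$, $D_TB=-\tau N$. Slant helix: $\alpha$ is a slant helix if there is a unit length left-invariant vector field $X\in\mathfrak{g}$ and a constant angle $\theta\ne\frac{\pi}{2}$ such that $\langle N(s),X\rangle=\cos\theta$ for all $s\in I$. Normal indicatrix: writing $N(s)=\sum_{i=1}^3n_i(s)X_i$, it is the parametrized curve $\gamma$ in $S^2\subset\mathfrak{g}$ given by $\gamma(s^* )=N(s)=\sum_{i=1}^3n_i(s)X_i$,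 where $s^*$ is the arc length parameter of $\gamma$. A plane curve is one contained in an affine plane of the three-dimensional Euclidean space $\mathfrak{g}$. *)

theory Defs
  imports "HOL-Analysis.Analysis" "HOL-Library.Function_Algebras"
begin

text \<open>Tangent vectors and vector fields are functions; pointwise operations make them elements of
  a real vector space, so that \<^const>\<open>span\<close>, \<^const>\<open>subspace\<close> and \<^const>\<open>dim\<close> apply to them.\<close>

instantiation "fun" :: (type, scaleR) scaleR
begin
definition scaleR_fun_def: "c *\<^sub>R f = (\<lambda>x. c *\<^sub>R f x)"
instance ..
end

instance "fun" :: (type, real_vector) real_vector
  by standard (simp_all add: scaleR_fun_def fun_eq_iff algebra_simps)

section \<open>Smooth maps\<close>

text \<open>All derivatives are taken within \<open>S\<close>. The notion is used only for open sets and for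
  relatively open subsets of non-degenerate real intervals, where such derivatives are unique
  (they are one-sided at the end points of an interval).\<close>

primrec Ck_on :: "nat \<Rightarrow> 'a::real_normed_vector set \<Rightarrow> ('a \<Rightarrow> 'b::real_normed_vector) \<Rightarrow> bool" where
  "Ck_on 0 S f \<longleftrightarrow> continuous_on S f"
| "Ck_on (Suc k) S f \<longleftrightarrow>
     f differentiable_on S \<and> (\<forall>v. Ck_on k S (\<lambda>x. frechet_derivative f (at x within S) v))"

definition smooth_on :: "'a::real_normed_vector set \<Rightarrow> ('a \<Rightarrow> 'b::real_normed_vector) \<Rightarrow> bool" where
  "smooth_on S f \<longleftrightarrow> (\<forall>k. Ck_on k S f)"

section \<open>Three-dimensional Lie groups\<close>

text \<open>The group is written additively, with identity \<open>0\<close>: the class \<^class>\<open>group_add\<close> underlying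
  \<^class>\<open>topological_group_add\<close> does not require commutativity. A smooth structure is given by an
  atlas, which need not be maximal; a chart is a domain together with a coordinate map.\<close>

type_synonym 'g chart = "'g set \<times> ('g \<Rightarrow> real^3)"

definition smooth_atlas :: "'g::topological_space chart set \<Rightarrow> bool" where
  "smooth_atlas A \<longleftrightarrow>
     (\<Union>(U, \<phi>)\<in>A. U) = UNIV \<and>
     (\<forall>(U, \<phi>)\<in>A. open U \<and> open (\<phi> ` U) \<and> homeomorphism U (\<phi> ` U) \<phi> (inv_into U \<phi>)) \<and>
     (\<forall>(U, \<phi>)\<in>A. \<forall>(V, \<psi>)\<in>A. smooth_on (\<phi> ` (U \<inter> V)) (\<psi> \<circ> inv_into U \<phi>))"

definition lie_group ::
    "'g::{topological_group_add, t2_space, second_countable_topology} chart set \<Rightarrow> bool" where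
  "lie_group A \<longleftrightarrow>
     smooth_atlas A \<and>
     (\<forall>(U, \<phi>)\<in>A. \<forall>(V, \<psi>)\<in>A. \<forall>(W, \<omega>)\<in>A.
        smooth_on {(x, y). x \<in> \<phi> ` U \<and> y \<in> \<psi> ` V \<and> inv_into U \<phi> x + inv_into V \<psi> y \<in> W}
          (\<lambda>(x, y). \<omega> (inv_into U \<phi> x + inv_into V \<psi> y))) \<and>
     (\<forall>(U, \<phi>)\<in>A. \<forall>(W, \<omega>)\<in>A.
        smooth_on {x \<in> \<phi> ` U. - inv_into U \<phi> x \<in> W} (\<lambda>x. \<omega> (- inv_into U \<phi> x)))"

definition smooth_fun :: "'g chart set \<Rightarrow> ('g \<Rightarrow> real) \<Rightarrow> bool" where
  "smooth_fun A f \<longleftrightarrow> (\<forall>(U, \<phi>)\<in>A. smooth_on (\<phi> ` U) (f \<circ> inv_into U \<phi>))"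

section \<open>Tangent vectors and the Lie algebra\<close>

text \<open>A tangent vector at \<open>p\<close> is a derivation at \<open>p\<close> of the algebra of smooth functions. It is
  extended by \<open>0\<close> to non-smooth functions, so that equality of tangent vectors is equality of
  functions.\<close>

type_synonym 'g tvec = "('g \<Rightarrow> real) \<Rightarrow> real"
type_synonym 'g vfield = "'g \<Rightarrow> 'g tvec"

definition tangent_space :: "'g chart set \<Rightarrow> 'g \<Rightarrow> 'g tvec set" where
  "tangent_space A p =
     {v. (\<forall>f g. smooth_fun A f \<longrightarrow> smooth_fun A g \<longrightarrow>
            v (\<lambda>q. f q + g q) = v f + v g \<and>
            v (\<lambda>q. f q * g q) = v f * g p + f p * v g) \<and>
         (\<forall>c f. smooth_fun A f \<longrightarrow> v (\<lambda>q. c * f q) = c * v f) \<and>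
         (\<forall>f. \<not> smooth_fun A f \<longrightarrow> v f = 0)}"

definition differential :: "('g \<Rightarrow> 'g) \<Rightarrow> 'g tvec \<Rightarrow> 'g tvec" where
  "differential F v = (\<lambda>f. v (f \<circ> F))"

definition vector_fields :: "'g chart set \<Rightarrow> 'g vfield set" where
  "vector_fields A =
     {X. (\<forall>p. X p \<in> tangent_space A p) \<and> (\<forall>f. smooth_fun A f \<longrightarrow> smooth_fun A (\<lambda>p. X p f))}"

definition lie_algebra :: "'g::group_add chart set \<Rightarrow> 'g vfield set" where
  "lie_algebra A =
     {X \<in> vector_fields A. \<forall>a p. X (a + p) = differential (\<lambda>q. a + q) (X p)}"

definition lie_bracket :: "'g vfield \<Rightarrow> 'g vfield \<Rightarrow> 'g vfield" where
  "lie_bracket X Y = (\<lambda>p f. X p (\<lambda>q. Y q f) - Y p (\<lambda>q. X q f))"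

section \<open>Bi-invariant metrics\<close>

type_synonym 'g metric = "'g \<Rightarrow> 'g tvec \<Rightarrow> 'g tvec \<Rightarrow> real"

definition riemannian_metric :: "'g chart set \<Rightarrow> 'g metric \<Rightarrow> bool" where
  "riemannian_metric A h \<longleftrightarrow>
     (\<forall>p. \<forall>u\<in>tangent_space A p. \<forall>v\<in>tangent_space A p. \<forall>w\<in>tangent_space A p. \<forall>c.
        h p u v = h p v u \<and>
        h p (u + v) w = h p u w + h p v w \<and>
        h p (c *\<^sub>R u) v = c * h p u v \<and>
        (u \<noteq> 0 \<longrightarrow> h p u u > 0)) \<and>
     (\<forall>X\<in>vector_fields A. \<forall>Y\<in>vector_fields A. smooth_fun A (\<lambda>p. h p (X p) (Y p)))"

definition bi_invariant_metric :: "'g::group_add chart set \<Rightarrow> 'g metric \<Rightarrow> bool" where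
  "bi_invariant_metric A h \<longleftrightarrow>
     riemannian_metric A h \<and>
     (\<forall>a p. \<forall>u\<in>tangent_space A p. \<forall>v\<in>tangent_space A p.
        h (a + p) (differential (\<lambda>q. a + q) u) (differential (\<lambda>q. a + q) v) = h p u v \<and>
        h (p + a) (differential (\<lambda>q. q + a) u) (differential (\<lambda>q. q + a) v) = h p u v)"

text \<open>For left-invariant fields and a left-invariant metric, \<open>h p (X p) (Y p)\<close> does not depend
  on \<open>p\<close>; the inner product on the Lie algebra is its value at the identity.\<close>

definition ginner :: "'g::group_add metric \<Rightarrow> 'g vfield \<Rightarrow> 'g vfield \<Rightarrow> real" where
  "ginner h X Y = h 0 (X 0) (Y 0)"

definition gnorm :: "'g::group_add metric \<Rightarrow> 'g vfield \<Rightarrow> real" where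
  "gnorm h X = sqrt (ginner h X X)"

definition orthonormal_basis ::
    "'g::group_add chart set \<Rightarrow> 'g metric \<Rightarrow> (3 \<Rightarrow> 'g vfield) \<Rightarrow> bool" where
  "orthonormal_basis A h E \<longleftrightarrow>
     (\<forall>i. E i \<in> lie_algebra A) \<and>
     (\<forall>i j. ginner h (E i) (E j) = (if i = j then 1 else 0)) \<and>
     span (range E) = lie_algebra A"

definition coords ::
    "'g::group_add metric \<Rightarrow> (3 \<Rightarrow> 'g vfield) \<Rightarrow> 'g vfield \<Rightarrow> real^3" where
  "coords h E X = (\<chi> i. ginner h X (E i))"

text \<open>The basis \<open>E\<close> is taken to be positively oriented.\<close>

definition gcross ::
    "'g::group_add metric \<Rightarrow> (3 \<Rightarrow> 'g vfield) \<Rightarrow> 'g vfield \<Rightarrow> 'g vfield \<Rightarrow> 'g vfield" where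
  "gcross h E X Y = (\<Sum>i\<in>UNIV. cross3 (coords h E X) (coords h E Y) $ i *\<^sub>R E i)"

section \<open>Curves\<close>

definition smooth_curve ::
    "'g::topological_space chart set \<Rightarrow> real set \<Rightarrow> (real \<Rightarrow> 'g) \<Rightarrow> bool" where
  "smooth_curve A I \<alpha> \<longleftrightarrow>
     continuous_on I \<alpha> \<and> (\<forall>(U, \<phi>)\<in>A. smooth_on {s \<in> I. \<alpha> s \<in> U} (\<phi> \<circ> \<alpha>))"

text \<open>A vector field along a curve, \<open>s \<mapsto> \<Sum>i. w i s *\<^sub>R E i\<close> with smooth coefficients \<open>w i\<close>, is
  represented as a curve in the Lie algebra: its value at the parameter \<open>s\<close> and the point \<open>\<alpha> s\<close>
  is the tangent vector \<open>W s (\<alpha> s)\<close>.\<close>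

definition field_along ::
    "'g::group_add chart set \<Rightarrow> 'g metric \<Rightarrow> (3 \<Rightarrow> 'g vfield) \<Rightarrow> real set \<Rightarrow>
     (real \<Rightarrow> 'g vfield) \<Rightarrow> bool" where
  "field_along A h E I W \<longleftrightarrow>
     (\<forall>s\<in>I. W s \<in> lie_algebra A) \<and> (\<forall>i. smooth_on I (\<lambda>s. ginner h (W s) (E i)))"

definition velocity_field ::
    "'g::group_add chart set \<Rightarrow> real set \<Rightarrow> (real \<Rightarrow> 'g) \<Rightarrow> (real \<Rightarrow> 'g vfield) \<Rightarrow> bool" where
  "velocity_field A I \<alpha> T \<longleftrightarrow>
     (\<forall>s\<in>I. T s \<in> lie_algebra A \<and>
        (\<forall>f. smooth_fun A f \<longrightarrow> ((f \<circ> \<alpha>) has_real_derivative T s (\<alpha> s) f) (at s within I)))"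

definition dot ::
    "'g::group_add metric \<Rightarrow> (3 \<Rightarrow> 'g vfield) \<Rightarrow> real set \<Rightarrow> (real \<Rightarrow> 'g vfield) \<Rightarrow>
     real \<Rightarrow> 'g vfield" where
  "dot h E I W s =
     (\<Sum>i\<in>UNIV. vector_derivative (\<lambda>t. ginner h (W t) (E i)) (at s within I) *\<^sub>R E i)"

text \<open>Covariant derivative along a curve with velocity \<open>T\<close>, for the Levi-Civita connection of a
  bi-invariant metric, which satisfies \<open>D\<^sub>X Y = [X, Y] / 2\<close> on left-invariant fields.\<close>

definition cov_deriv ::
    "'g::group_add metric \<Rightarrow> (3 \<Rightarrow> 'g vfield) \<Rightarrow> real set \<Rightarrow> (real \<Rightarrow> 'g vfield) \<Rightarrow>
     (real \<Rightarrow> 'g vfield) \<Rightarrow> real \<Rightarrow> 'g vfield" where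
  "cov_deriv h E I T W s = dot h E I W s + (1/2) *\<^sub>R lie_bracket (T s) (W s)"

definition frenet_apparatus ::
    "'g::{group_add, topological_space} chart set \<Rightarrow> 'g metric \<Rightarrow> (3 \<Rightarrow> 'g vfield) \<Rightarrow> real set \<Rightarrow>
     (real \<Rightarrow> 'g) \<Rightarrow> (real \<Rightarrow> 'g vfield) \<Rightarrow> (real \<Rightarrow> 'g vfield) \<Rightarrow> (real \<Rightarrow> 'g vfield) \<Rightarrow>
     (real \<Rightarrow> real) \<Rightarrow> (real \<Rightarrow> real) \<Rightarrow> bool" where
  "frenet_apparatus A h E I \<alpha> T N B \<kappa> \<tau> \<longleftrightarrow>
     velocity_field A I \<alpha> T \<and>
     field_along A h E I T \<and> field_along A h E I N \<and> field_along A h E I B \<and>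
     (\<forall>s\<in>I.
        gnorm h (T s) = 1 \<and> gnorm h (N s) = 1 \<and> ginner h (T s) (N s) = 0 \<and>
        B s = gcross h E (T s) (N s) \<and>
        \<kappa> s = gnorm h (dot h E I T s) \<and> \<kappa> s > 0 \<and>
        cov_deriv h E I T T s = \<kappa> s *\<^sub>R N s \<and>
        cov_deriv h E I T N s = - (\<kappa> s *\<^sub>R T s) + \<tau> s *\<^sub>R B s \<and>
        cov_deriv h E I T B s = - (\<tau> s *\<^sub>R N s))"

text \<open>The property of being a slant helix, for a curve on \<open>I\<close> with principal normal \<open>N\<close>.\<close>

definition slant_helix ::
    "'g::group_add chart set \<Rightarrow> 'g metric \<Rightarrow> real set \<Rightarrow> (real \<Rightarrow> 'g vfield) \<Rightarrow> bool" where
  "slant_helix A h I N \<longleftrightarrow>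
     (\<exists>X\<in>lie_algebra A. gnorm h X = 1 \<and>
        (\<exists>\<theta>\<in>{0..pi}. \<theta> \<noteq> pi / 2 \<and> (\<forall>s\<in>I. ginner h (N s) X = cos \<theta>)))"

text \<open>\<open>\<gamma>\<close> is the curve \<open>N\<close> reparametrized by its arc length \<open>\<sigma>\<close>, which is determined up to an
  additive constant by \<open>d\<sigma>/ds = \<parallel>dN/ds\<parallel>\<close> and maps \<open>I\<close> onto the parameter interval \<open>J\<close> of \<open>\<gamma>\<close>.\<close>

definition normal_indicatrix ::
    "'g::group_add metric \<Rightarrow> (3 \<Rightarrow> 'g vfield) \<Rightarrow> real set \<Rightarrow> (real \<Rightarrow> 'g vfield) \<Rightarrow>
     real set \<Rightarrow> (real \<Rightarrow> 'g vfield) \<Rightarrow> bool" where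
  "normal_indicatrix h E I N J \<gamma> \<longleftrightarrow>
     (\<exists>\<sigma>. (\<forall>s\<in>I. (\<sigma> has_real_derivative gnorm h (dot h E I N s)) (at s within I)) \<and>
          \<sigma> ` I = J \<and> (\<forall>s\<in>I. \<gamma> (\<sigma> s) = N s))"

definition unit_sphere :: "'g::group_add chart set \<Rightarrow> 'g metric \<Rightarrow> 'g vfield set" where
  "unit_sphere A h = {X \<in> lie_algebra A. gnorm h X = 1}"

definition affine_plane :: "'g::group_add chart set \<Rightarrow> 'g vfield set \<Rightarrow> bool" where
  "affine_plane A P \<longleftrightarrow>
     (\<exists>Q\<in>lie_algebra A. \<exists>S\<subseteq>lie_algebra A. subspace S \<and> dim S = 2 \<and> P = (\<lambda>V. Q + V) ` S)"

definition plane_curve ::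
    "'g::group_add chart set \<Rightarrow> real set \<Rightarrow> (real \<Rightarrow> 'g vfield) \<Rightarrow> bool" where
  "plane_curve A J \<gamma> \<longleftrightarrow> (\<exists>P. affine_plane A P \<and> \<gamma> ` J \<subseteq> P)"

end

theory Submission
  imports Defs
begin

text \<open>The curve \<open>\<gamma>\<close> is a reparametrization of \<open>N\<close>, so the two have the same image in the
  Euclidean space \<open>\<gg>\<close>. The principal normal has unit length, which puts this image on the
  sphere. If \<open>X\<close> is the axis of the slant helix, then the function \<open>\<langle>N, X\<rangle>\<close> is
  constantly \<open>cos \<theta>\<close>, and since \<open>\<langle>X, X\<rangle> = 1\<close>, every \<open>N s - cos \<theta> X\<close> is
  orthogonal to \<open>X\<close>. Hence the image lies in the translate by \<open>cos \<theta> X\<close> of the orthogonal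
  complement of \<open>X\<close>. That complement is a plane, being the kernel of a nonzero linear functional
  on the three-dimensional space \<open>\<gg>\<close> (\<open>dim_kernel_functional\<close>, \<open>dim_lie_algebra\<close>).

  The metric is bilinear on tangent vectors only, so \<open>\<langle>V, X\<rangle>\<close> is a linear functional of
  \<open>V\<close> on the subspace \<open>\<gg>\<close> and not on the whole function space around it.\<close>

lemma subspace_kernel_functional:
  fixes L :: "'v::real_vector set" and f :: "'v \<Rightarrow> real"
  assumes "subspace L"
    and add: "\<And>u v. u \<in> L \<Longrightarrow> v \<in> L \<Longrightarrow> f (u + v) = f u + f v"
    and scale: "\<And>c v. v \<in> L \<Longrightarrow> f (c *\<^sub>R v) = c * f v"
  shows "subspace {v \<in> L. f v = 0}"
proof -
  have "0 \<in> L"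
    using \<open>subspace L\<close> by (rule subspace_0)
  then have "f 0 = 0"
    using scale[of 0 0] by simp
  with \<open>0 \<in> L\<close> show ?thesis
    using \<open>subspace L\<close> by (auto simp: subspace_def add scale)
qed

text \<open>A vector \<open>x\<close> outside the kernel extends any basis of the kernel to a basis of \<open>L\<close>, because
  \<open>v - (f v / f x) x\<close> lies in the kernel for every \<open>v\<close>.\<close>

lemma dim_kernel_functional:
  fixes F :: "'v::real_vector set" and f :: "'v \<Rightarrow> real"
  assumes "finite F"
    and add: "\<And>u v. u \<in> span F \<Longrightarrow> v \<in> span F \<Longrightarrow> f (u + v) = f u + f v"
    and scale: "\<And>c v. v \<in> span F \<Longrightarrow> f (c *\<^sub>R v) = c * f v"
    and x: "x \<in> span F" "f x \<noteq> 0"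
  shows "dim F = Suc (dim {v \<in> span F. f v = 0})"
proof -
  define K where "K = {v \<in> span F. f v = 0}"
  have "subspace K"
    unfolding K_def using subspace_span add scale by (rule subspace_kernel_functional)
  obtain C where C: "C \<subseteq> K" "independent C" "K \<subseteq> span C" "card C = dim K"
    by (rule basis_exists)
  have span_C: "span C = K"
    using C \<open>subspace K\<close> by (simp add: span_subspace)
  have "C \<subseteq> span F"
    using C by (auto simp: K_def)
  then have "finite C"
    using independent_span_bound[OF \<open>finite F\<close> C(2)] by blast
  have "x \<notin> span C"
    using x by (simp add: span_C K_def)
  then have "x \<notin> C"
    using span_base by blast
  have ind: "independent (insert x C)"
    using C(2) \<open>x \<notin> span C\<close> by (rule independent_insertI[rotated])
  have "span (insert x C) = span F"
  proof
    show "span (insert x C) \<subseteq> span F"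
      using x \<open>C \<subseteq> span F\<close> by (intro span_minimal) (auto simp: subspace_span)
    show "span F \<subseteq> span (insert x C)"
    proof
      fix v assume v: "v \<in> span F"
      have "f (v + (- (f v / f x)) *\<^sub>R x) = f v + (- (f v / f x)) * f x"
        using v x by (simp only: add scale span_scale)
      also have "\<dots> = 0"
        using x by simp
      finally have "v - (f v / f x) *\<^sub>R x \<in> K"
        using v x by (simp add: K_def span_diff span_scale)
      then show "v \<in> span (insert x C)"
        by (auto simp: span_breakdown_eq span_C)
    qed
  qed
  then have "dim F = card (insert x C)"
    using ind by (intro dim_eq_card)
  also have "\<dots> = Suc (dim K)"
    using \<open>finite C\<close> \<open>x \<notin> C\<close> C by simp
  finally show ?thesis
    by (simp add: K_def)
qed

lemma ginner_add_left:
  assumes "bi_invariant_metric A h"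
    and "X \<in> lie_algebra A" "Y \<in> lie_algebra A" "Z \<in> lie_algebra A"
  shows "ginner h (X + Y) Z = ginner h X Z + ginner h Y Z"
  using assms
  by (simp add: bi_invariant_metric_def riemannian_metric_def lie_algebra_def vector_fields_def
      ginner_def plus_fun_def[of X Y])

lemma ginner_scaleR_left:
  assumes "bi_invariant_metric A h" and "X \<in> lie_algebra A" "Y \<in> lie_algebra A"
  shows "ginner h (c *\<^sub>R X) Y = c * ginner h X Y"
proof -
  have "X 0 \<in> tangent_space A 0" "Y 0 \<in> tangent_space A 0"
    using assms by (auto simp: lie_algebra_def vector_fields_def)
  then have "h 0 (c *\<^sub>R X 0) (Y 0) = c * h 0 (X 0) (Y 0)"
    using assms(1) by (auto simp: bi_invariant_metric_def riemannian_metric_def)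
  then show ?thesis
    by (simp add: ginner_def scaleR_fun_def[of c X])
qed

text \<open>Orthonormal vectors are independent: pairing with \<open>E i\<close> annihilates the span of the other
  basis vectors, but not \<open>E i\<close> itself.\<close>

lemma dim_lie_algebra:
  assumes h: "bi_invariant_metric A h" and E: "orthonormal_basis A h E"
  shows "dim (lie_algebra A) = 3"
proof -
  have span_E: "span (range E) = lie_algebra A"
    and E_in: "E i \<in> lie_algebra A"
    and ortho: "ginner h (E i) (E j) = (if i = j then 1 else 0)" for i j
    using E by (simp_all add: orthonormal_basis_def)
  have sub: "subspace (lie_algebra A)"
    by (metis span_E subspace_span)
  have "inj E"
    by (rule injI) (metis ortho zero_neq_one)
  have "E i \<notin> span (range E - {E i})" for i
  proof
    let ?K = "{V \<in> lie_algebra A. ginner h V (E i) = 0}"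
    assume "E i \<in> span (range E - {E i})"
    moreover have "range E - {E i} \<subseteq> ?K"
      using E_in ortho by auto
    moreover have "subspace ?K"
      using sub h E_in
      by (intro subspace_kernel_functional) (auto intro: ginner_add_left ginner_scaleR_left)
    ultimately have "E i \<in> ?K"
      using span_minimal by blast
    then show False
      using ortho by simp
  qed
  then have "independent (range E)"
    by (auto simp: dependent_def)
  then have "dim (lie_algebra A) = card (range E)"
    using span_E by (metis dim_span_eq_card_independent)
  also have "\<dots> = 3"
    using \<open>inj E\<close> by (simp add: card_image)
  finally show ?thesis .
qed

text \<open>The equation \<open>\<langle>V, X\<rangle> = c\<close> cuts out the plane through \<open>c X\<close> orthogonal to \<open>X\<close>, as \<open>X\<close>
  is a unit vector.\<close>

lemma affine_plane_level_set:
  assumes h: "bi_invariant_metric A h" and E: "orthonormal_basis A h E"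
    and X: "X \<in> lie_algebra A" "gnorm h X = 1"
  shows "affine_plane A {V \<in> lie_algebra A. ginner h V X = c}"
proof -
  let ?L = "lie_algebra A"
  define S where "S = {V \<in> ?L. ginner h V X = 0}"
  have span_E: "span (range E) = ?L"
    using E by (simp add: orthonormal_basis_def)
  then have sub: "subspace ?L"
    by (metis subspace_span)
  have XX: "ginner h X X = 1"
    using X by (simp add: gnorm_def)
  have cX: "c *\<^sub>R X \<in> ?L"
    using sub X by (simp add: subspace_scale)
  have "subspace S"
    unfolding S_def using sub h X
    by (intro subspace_kernel_functional) (auto intro: ginner_add_left ginner_scaleR_left)
  have "dim (range E) = Suc (dim {V \<in> span (range E). ginner h V X = 0})"
    using h X XX span_E
    by (intro dim_kernel_functional[where x = X])
      (auto intro: ginner_add_left ginner_scaleR_left)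
  then have "dim S = 2"
    using dim_lie_algebra[OF h E] by (simp add: span_E S_def flip: dim_span[of "range E"])
  have "{V \<in> ?L. ginner h V X = c} = (\<lambda>V. c *\<^sub>R X + V) ` S"
  proof (intro equalityI subsetI)
    fix V assume "V \<in> {V \<in> ?L. ginner h V X = c}"
    then have V: "V \<in> ?L" "ginner h V X = c"
      by auto
    have "ginner h (V + (- c) *\<^sub>R X) X = c + (- c) * 1"
      using V X XX sub by (simp only: ginner_add_left[OF h] ginner_scaleR_left[OF h] subspace_scale)
    then have "V - c *\<^sub>R X \<in> S"
      using V cX sub by (simp add: S_def subspace_diff)
    then show "V \<in> (\<lambda>V. c *\<^sub>R X + V) ` S"
      by (intro image_eqI[where x = "V - c *\<^sub>R X"]) simp_all
  next
    fix V assume "V \<in> (\<lambda>V. c *\<^sub>R X + V) ` S"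
    then show "V \<in> {V \<in> ?L. ginner h V X = c}"
      using X XX cX sub
      by (auto simp: S_def subspace_add ginner_add_left[OF h] ginner_scaleR_left[OF h])
  qed
  moreover have "S \<subseteq> ?L"
    by (auto simp: S_def)
  ultimately show ?thesis
    unfolding affine_plane_def using cX \<open>subspace S\<close> \<open>dim S = 2\<close> by blast
qed

theorem theorem4p5:
  fixes A :: "'g::{topological_group_add, t2_space, second_countable_topology} chart set"
    and h :: "'g metric"
    and E :: "3 \<Rightarrow> 'g vfield"
    and I J :: "real set"
    and \<alpha> :: "real \<Rightarrow> 'g"
    and T N B \<gamma> :: "real \<Rightarrow> 'g vfield"
    and \<kappa> \<tau> :: "real \<Rightarrow> real"
  assumes "lie_group A"
    and "bi_invariant_metric A h"
    and "orthonormal_basis A h E"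
    and "is_interval I" and "interior I \<noteq> {}"
    and "smooth_curve A I \<alpha>"
    and "frenet_apparatus A h E I \<alpha> T N B \<kappa> \<tau>"
    and "slant_helix A h I N"
    and "normal_indicatrix h E I N J \<gamma>"
  shows "\<gamma> ` J \<subseteq> unit_sphere A h \<and> plane_curve A J \<gamma>"
proof -
  have image: "\<gamma> ` J = N ` I"
  proof -
    obtain \<sigma> where "\<sigma> ` I = J" and "\<forall>s\<in>I. \<gamma> (\<sigma> s) = N s"
      using assms(9) unfolding normal_indicatrix_def by blast
    then show ?thesis
      by (auto simp: image_image simp flip: \<open>\<sigma> ` I = J\<close>)
  qed
  have N: "N s \<in> lie_algebra A" "gnorm h (N s) = 1" if "s \<in> I" for s
    using assms(7) that by (auto simp: frenet_apparatus_def field_along_def)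
  obtain X \<theta> where X: "X \<in> lie_algebra A" "gnorm h X = 1"
    and angle: "\<And>s. s \<in> I \<Longrightarrow> ginner h (N s) X = cos \<theta>"
    using assms(8) by (auto simp: slant_helix_def)
  let ?P = "{V \<in> lie_algebra A. ginner h V X = cos \<theta>}"
  have "affine_plane A ?P"
    using assms(2,3) X by (rule affine_plane_level_set)
  moreover have "\<gamma> ` J \<subseteq> ?P"
    using N angle by (auto simp: image)
  ultimately have "plane_curve A J \<gamma>"
    unfolding plane_curve_def by blast
  moreover have "\<gamma> ` J \<subseteq> unit_sphere A h"
    using N by (auto simp: image unit_sphere_def)
  ultimately show ?thesis
    by blast
qed

end
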